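(* Let $\mathcal{P}=\langle x_1,\ldots,x_n\,\|\,r_1,\ldots,r_m\rangle$ be a finite presentation of a group $G$, let $A_n=\mathbb{Q}[[X_1,\ldots,X_n]]$ be the algebra of formal power series in noncommuting variables $X_1,\ldots,X_n$ over $\mathbb{Q}$, and put $$f_j=r_j(1+X_1,\ldots,1+X_n)-1\in A_n,\qquad j=1,\ldots,m.$$ Then the quotient algebra $A_n/\langle f_1,\ldots,f_m\rangle$ is an invariant of the group $G$, i.e. it does not depend on the explicit presentation.
   Context: Here $r_j(1+X_1,\ldots,1+X_n)$ denotes the image of the word $r_j$ under the homomorphism from the free group on $x_1,\dots,x_n$ to the group of units of $A_n$ sending $x_i\mapsto 1+X_i$, $x_i^{-1}\mapsto 1-X_i+X_i^2-\cdots$. $\langle f_1,\ldots,f_m\rangle$ denotes the two-sided ideal of $A_n$ generated by $f_1,\dots,f_m$.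
   Formalization: ⟨f_1,…,f_m⟩ is taken as the closure, in the power series topology of A_n, of the generated two-sided ideal; for the ideal itself the claim fails: ⟨x | ⟩ and ⟨x,y | y⟩ both present Z, but A_1 is commutative and A_2/⟨Y⟩ is not. *)

theory Defs
  imports "HOL-Analysis.Function_Topology" "HOL-Algebra.QuotRing" "HOL-Algebra.Module"
begin

section \<open>Free groups and presentations\<close>

text \<open>
  A letter \<^term>\<open>(i, True)\<close> stands for $x_{i+1}$ and \<^term>\<open>(i, False)\<close> for its inverse. Elements of the
  free group are the reduced words; \<^term>\<open>foldr push_letter u v\<close> is the reduced form of the
  concatenation of \<open>u\<close> with the reduced word \<open>v\<close>.
\<close>

type_synonym letter = "nat \<times> bool"

definition letter_inv :: "letter \<Rightarrow> letter" where
  "letter_inv l = (fst l, \<not> snd l)"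

definition reduced :: "letter list \<Rightarrow> bool" where
  "reduced = successively (\<lambda>a b. b \<noteq> letter_inv a)"

definition push_letter :: "letter \<Rightarrow> letter list \<Rightarrow> letter list" where
  "push_letter l w =
     (case w of [] \<Rightarrow> [l] | l' # w' \<Rightarrow> if l' = letter_inv l then w' else l # w)"

definition free_group :: "nat \<Rightarrow> letter list monoid" where
  "free_group n =
     \<lparr>carrier = {w. fst ` set w \<subseteq> {..<n} \<and> reduced w},
      mult = (\<lambda>u v. foldr push_letter u v),
      one = []\<rparr>"

definition normal_closure :: "('a, 'b) monoid_scheme \<Rightarrow> 'a set \<Rightarrow> 'a set" where
  "normal_closure G S = \<Inter>{N. N \<lhd> G \<and> S \<subseteq> N}"

definition is_presentation ::
  "nat \<Rightarrow> letter list list \<Rightarrow> ('g, 'b) monoid_scheme \<Rightarrow> bool" where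
  "is_presentation n rs G \<longleftrightarrow>
     set rs \<subseteq> carrier (free_group n) \<and>
     free_group n Mod normal_closure (free_group n) (set rs) \<cong> G"


section \<open>Noncommutative formal power series\<close>

text \<open>
  A series is given by its coefficients: \<open>f w\<close> is the coefficient of the monomial
  $X_{w_1} \cdots X_{w_k}$, where \<open>w\<close> is a word in the indices \<^term>\<open>{..<n}\<close>. The record type
  \<open>module\<close> is used for its scalar multiplication; the locale \<open>algebra\<close> does not apply because it
  requires commutativity.
\<close>

type_synonym series = "nat list \<Rightarrow> rat"

definition ser_mult :: "series \<Rightarrow> series \<Rightarrow> series" where
  "ser_mult f g w = (\<Sum>k\<le>length w. f (take k w) * g (drop k w))"

definition ser_one :: series where
  "ser_one w = (if w = [] then 1 else 0)"

definition ser_alg :: "nat \<Rightarrow> (rat, series) module" where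
  "ser_alg n =
     \<lparr>carrier = {f. \<forall>w. f w \<noteq> 0 \<longrightarrow> set w \<subseteq> {..<n}},
      mult = ser_mult,
      one = ser_one,
      zero = (\<lambda>w. 0),
      add = (\<lambda>f g w. f w + g w),
      smult = (\<lambda>c f w. c * f w)\<rparr>"

definition ser_var :: "nat \<Rightarrow> series" where
  "ser_var i w = (if w = [i] then 1 else 0)"

text \<open>The geometric series $1 - X + X^2 - \cdots$ in the \<open>i\<close>-th variable\<close>

definition ser_geom :: "nat \<Rightarrow> series" where
  "ser_geom i w = (if set w \<subseteq> {i} then (- 1) ^ length w else 0)"

definition magnus_letter :: "letter \<Rightarrow> series" where
  "magnus_letter l =
     (if snd l then (\<lambda>w. ser_one w + ser_var (fst l) w) else ser_geom (fst l))"

text \<open>The word \<open>r\<close> evaluated at $1 + X_1, \ldots, 1 + X_n$\<close>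

definition magnus :: "letter list \<Rightarrow> series" where
  "magnus r = foldr (\<lambda>l. ser_mult (magnus_letter l)) r ser_one"

definition relator_series :: "letter list \<Rightarrow> series" where
  "relator_series r = (\<lambda>w. magnus r w - ser_one w)"

definition ser_topology :: "nat \<Rightarrow> series topology" where
  "ser_topology n =
     subtopology (product_topology (\<lambda>_. discrete_topology UNIV) UNIV) (carrier (ser_alg n))"

text \<open>
  The ideal generated by the relator series is taken in the sense of the topological algebra of
  power series, i.e. it is the closure of the algebraic ideal \<^term>\<open>Idl\<^bsub>ser_alg n\<^esub> S\<close>. The closure
  cannot be omitted: with \<open>X\<close>, \<open>Y\<close> as the two variables, the presentations
  $\langle x \| \ \rangle$ and $\langle x, y \| y \rangle$ define the same group, but the series
  $\sum_i X^i Y X^i$ is not a finite sum of products $a Y b$, and the quotient by the algebraic ideal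
  generated by \<open>Y\<close> is not commutative, whereas $\mathbb{Q}[[X]]$ is.
\<close>

definition relator_ideal :: "nat \<Rightarrow> letter list list \<Rightarrow> series set" where
  "relator_ideal n rs =
     Abstract_Topology.closure_of (ser_topology n) (Idl\<^bsub>ser_alg n\<^esub> (relator_series ` set rs))"


section \<open>Quotient algebras and algebra isomorphisms\<close>

definition quot_alg :: "('k, 'a) module \<Rightarrow> 'a set \<Rightarrow> ('k, 'a set) module" where
  "quot_alg A I =
     ring.extend (A Quot I) (module.fields (\<lambda>c C. \<Union>a\<in>C. I +>\<^bsub>A\<^esub> (c \<odot>\<^bsub>A\<^esub> a)))"

definition alg_iso :: "('k, 'a) module \<Rightarrow> ('k, 'b) module \<Rightarrow> ('a \<Rightarrow> 'b) set" where
  "alg_iso A B =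
     {h \<in> ring_iso A B. \<forall>c. \<forall>a\<in>carrier A. h (c \<odot>\<^bsub>A\<^esub> a) = c \<odot>\<^bsub>B\<^esub> h a}"

definition is_alg_iso :: "('k, 'a) module \<Rightarrow> ('k, 'b) module \<Rightarrow> bool" where
  "is_alg_iso A B \<longleftrightarrow> alg_iso A B \<noteq> {}"

definition presentation_alg :: "nat \<Rightarrow> letter list list \<Rightarrow> (rat, series set) module" where
  "presentation_alg n rs = quot_alg (ser_alg n) (relator_ideal n rs)"


section \<open>Basic facts\<close>

lemma letter_inv_inv [simp]: "letter_inv (letter_inv l) = l"
  by (simp add: letter_inv_def)

lemma fst_letter_inv [simp]: "fst (letter_inv l) = fst l"
  by (simp add: letter_inv_def)

lemma letter_inv_neq [simp]: "letter_inv l \<noteq> l" "l \<noteq> letter_inv l"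
  by (auto simp: letter_inv_def prod_eq_iff)

lemma reduced_simps [simp]:
  "reduced []" "reduced [a]"
  "reduced (a # b # w) \<longleftrightarrow> b \<noteq> letter_inv a \<and> reduced (b # w)"
  by (auto simp: reduced_def)

lemma reduced_tl: "reduced (a # w) \<Longrightarrow> reduced w"
  by (cases w) auto

lemma reduced_push: "reduced w \<Longrightarrow> reduced (push_letter l w)"
  by (cases w) (auto simp: push_letter_def dest: reduced_tl)

lemma push_push_inv: "reduced w \<Longrightarrow> push_letter l (push_letter (letter_inv l) w) = w"
  by (cases w; cases "tl w") (auto simp: push_letter_def)

lemma push_reduced: "reduced (l # w) \<Longrightarrow> push_letter l w = l # w"
  by (cases w) (auto simp: push_letter_def)

lemma foldr_push_reduced: "reduced v \<Longrightarrow> reduced (foldr push_letter u v)"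
  by (induction u) (auto intro: reduced_push)

lemma foldr_push_Nil: "reduced u \<Longrightarrow> foldr push_letter u [] = u"
proof (induction u)
  case (Cons l u)
  then show ?case using reduced_tl[of l u] by (simp add: push_reduced del: split_paired_All)
qed simp

lemma foldr_push_push:
  "reduced u \<Longrightarrow> reduced v \<Longrightarrow>
   foldr push_letter (push_letter l u) v = push_letter l (foldr push_letter u v)"
proof (cases u)
  case (Cons a u')
  assume "reduced v"
  then have *: "push_letter l (push_letter (letter_inv l) (foldr push_letter u' v)) =
      foldr push_letter u' v"
    by (intro push_push_inv foldr_push_reduced)
  show ?thesis
  proof (cases "a = letter_inv l")
    case True
    then show ?thesis using Cons * by (simp add: push_letter_def[of l "_ # _"])
  next
    case False
    then show ?thesis using Cons by (simp add: push_letter_def[of l "_ # _"])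
  qed
qed (simp add: push_letter_def[of l "[]"])

lemma foldr_push_assoc:
  "reduced v \<Longrightarrow> reduced w \<Longrightarrow>
   foldr push_letter (foldr push_letter u v) w = foldr push_letter u (foldr push_letter v w)"
  by (induction u) (auto simp: foldr_push_push foldr_push_reduced)

lemma set_push: "set (push_letter l w) \<subseteq> insert l (set w)"
  by (cases w) (auto simp: push_letter_def)

lemma set_foldr_push: "set (foldr push_letter u v) \<subseteq> set u \<union> set v"
proof (induction u)
  case (Cons l u)
  then show ?case using set_push[of l "foldr push_letter u v"] by auto
qed auto

lemma foldr_push_inverse:
  "reduced v \<Longrightarrow> foldr push_letter (rev (map letter_inv u)) (foldr push_letter u v) = v"
proof (induction u)
  case (Cons l u)
  then show ?case
    using push_push_inv[OF foldr_push_reduced, of v "letter_inv l" u] by simp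
qed simp

lemma reduced_rev_inv: "reduced u \<Longrightarrow> reduced (rev (map letter_inv u))"
proof -
  have *: "(letter_inv x \<noteq> letter_inv (letter_inv y)) = (y \<noteq> letter_inv x)" for x y
    by (metis letter_inv_inv)
  show "reduced u \<Longrightarrow> reduced (rev (map letter_inv u))"
    unfolding reduced_def by (simp only: successively_rev successively_map *)
qed

lemma group_free_group: "group (free_group n)"
proof (rule groupI)
  fix x y assume "x \<in> carrier (free_group n)" "y \<in> carrier (free_group n)"
  then show "x \<otimes>\<^bsub>free_group n\<^esub> y \<in> carrier (free_group n)"
    using set_foldr_push[of x y] by (fastforce simp: free_group_def foldr_push_reduced)
next
  fix x assume x: "x \<in> carrier (free_group n)"
  have "rev (map letter_inv x) \<in> carrier (free_group n)"
    using x by (auto simp: free_group_def reduced_rev_inv)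
  moreover have "rev (map letter_inv x) \<otimes>\<^bsub>free_group n\<^esub> x = \<one>\<^bsub>free_group n\<^esub>"
    using foldr_push_inverse[of "[]" x] x by (simp add: free_group_def foldr_push_Nil)
  ultimately show "\<exists>y\<in>carrier (free_group n). y \<otimes>\<^bsub>free_group n\<^esub> x = \<one>\<^bsub>free_group n\<^esub>" by blast
qed (auto simp: free_group_def foldr_push_assoc)

lemma ser_mult_Nil [simp]: "ser_mult f g [] = f [] * g []"
  by (simp add: ser_mult_def)

lemma ser_mult_Cons:
  "ser_mult f g (x # w) = f [] * g (x # w) + ser_mult (\<lambda>v. f (x # v)) g w"
  by (simp add: ser_mult_def sum.atMost_Suc_shift del: sum.atMost_Suc)

lemma ser_mult_add_left: "ser_mult (\<lambda>w. f w + g w) h w = ser_mult f h w + ser_mult g h w"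
  by (simp add: ser_mult_def sum.distrib ring_distribs)

lemma ser_mult_add_right: "ser_mult h (\<lambda>w. f w + g w) w = ser_mult h f w + ser_mult h g w"
  by (simp add: ser_mult_def sum.distrib ring_distribs)

lemma ser_mult_scale_left: "ser_mult (\<lambda>w. c * f w) h w = c * ser_mult f h w"
  by (simp add: ser_mult_def sum_distrib_left mult_ac)

lemma ser_mult_scale_right: "ser_mult h (\<lambda>w. c * f w) w = c * ser_mult h f w"
  by (simp add: ser_mult_def sum_distrib_left mult_ac)

lemma ser_mult_assoc: "ser_mult (ser_mult f g) h = ser_mult f (ser_mult g h)"
proof
  show "ser_mult (ser_mult f g) h w = ser_mult f (ser_mult g h) w" for w
    by (induction w arbitrary: f)
       (simp_all add: ser_mult_Cons ser_mult_add_left ser_mult_scale_left algebra_simps)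
qed

lemma ser_mult_zero_left: "ser_mult (\<lambda>w. 0) g w = 0"
  by (simp add: ser_mult_def)

lemma ser_mult_one_left [simp]: "ser_mult ser_one f = f"
proof
  show "ser_mult ser_one f w = f w" for w
    by (cases w) (simp_all add: ser_mult_Cons ser_one_def ser_mult_zero_left)
qed

lemma ser_mult_one_right [simp]: "ser_mult f ser_one = f"
proof
  show "ser_mult f ser_one w = f w" for w
    by (induction w arbitrary: f) (simp_all add: ser_mult_Cons ser_one_def)
qed

lemma ser_mult_closed:
  assumes "f \<in> carrier (ser_alg n)" "g \<in> carrier (ser_alg n)"
  shows "ser_mult f g \<in> carrier (ser_alg n)"
proof -
  have "set w \<subseteq> {..<n}" if "ser_mult f g w \<noteq> 0" for w
  proof -
    obtain k where "f (take k w) * g (drop k w) \<noteq> 0"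
      using \<open>ser_mult f g w \<noteq> 0\<close> unfolding ser_mult_def by (meson sum.neutral)
    then have "set (take k w) \<union> set (drop k w) \<subseteq> {..<n}"
      using assms by (auto simp: ser_alg_def)
    then show ?thesis by (metis append_take_drop_id set_append)
  qed
  then show ?thesis by (simp add: ser_alg_def)
qed

lemma ring_ser_alg: "ring (ser_alg n)"
proof (rule ringI)
  show "abelian_group (ser_alg n)"
  proof (rule abelian_groupI)
    fix f assume f: "f \<in> carrier (ser_alg n)"
    show "\<exists>g\<in>carrier (ser_alg n). g \<oplus>\<^bsub>ser_alg n\<^esub> f = \<zero>\<^bsub>ser_alg n\<^esub>"
      using f by (intro bexI[of _ "\<lambda>w. - f w"]) (auto simp: ser_alg_def)
  next
    fix f g assume "f \<in> carrier (ser_alg n)" "g \<in> carrier (ser_alg n)"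
    then show "f \<oplus>\<^bsub>ser_alg n\<^esub> g \<in> carrier (ser_alg n)"
      by (simp add: ser_alg_def) (metis add.right_neutral)
  qed (auto simp: ser_alg_def algebra_simps)
  show "monoid (ser_alg n)"
  proof -
    have "ser_one \<in> carrier (ser_alg n)" by (simp add: ser_alg_def ser_one_def)
    moreover have "mult (ser_alg n) = ser_mult" "one (ser_alg n) = ser_one"
      by (simp_all add: ser_alg_def)
    ultimately show ?thesis
      by (intro monoidI) (simp_all add: ser_mult_closed ser_mult_assoc)
  qed
qed (auto simp: ser_alg_def ser_mult_add_left ser_mult_add_right)

lemma ser_geom_left: "ser_mult (ser_geom i) (\<lambda>w. ser_one w + ser_var i w) = ser_one"
proof
  have *: "(\<lambda>v. ser_geom i (x # v)) = (\<lambda>v. (if x = i then - 1 else 0) * ser_geom i v)" for x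
    by (auto simp: ser_geom_def)
  show "ser_mult (ser_geom i) (\<lambda>w. ser_one w + ser_var i w) w = ser_one w" for w
  proof (induction w)
    case (Cons x w)
    then show ?case
      unfolding ser_mult_Cons * ser_mult_scale_left
      by (simp add: ser_geom_def ser_one_def ser_var_def)
  qed (simp add: ser_geom_def ser_one_def ser_var_def)
qed

lemma ser_geom_right: "ser_mult (\<lambda>w. ser_one w + ser_var i w) (ser_geom i) = ser_one"
proof
  have *: "(\<lambda>v. ser_one (x # v) + ser_var i (x # v)) = (\<lambda>v. (if x = i then 1 else 0) * ser_one v)"
    for x by (auto simp: ser_one_def ser_var_def)
  show "ser_mult (\<lambda>w. ser_one w + ser_var i w) (ser_geom i) w = ser_one w" for w
  proof (cases w)
    case (Cons x v)
    show ?thesis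
      unfolding Cons ser_mult_Cons * ser_mult_scale_left ser_mult_one_left
      by (simp add: ser_geom_def ser_one_def ser_var_def)
  qed (simp add: ser_geom_def ser_one_def ser_var_def)
qed

lemma magnus_letter_inv:
  "ser_mult (magnus_letter l) (magnus_letter (letter_inv l)) = ser_one"
  by (auto simp: magnus_letter_def letter_inv_def ser_geom_left ser_geom_right)

lemma magnus_Nil [simp]: "magnus [] = ser_one"
  by (simp add: magnus_def)

lemma magnus_Cons [simp]: "magnus (l # w) = ser_mult (magnus_letter l) (magnus w)"
  by (simp add: magnus_def)

lemma magnus_push: "magnus (push_letter l w) = ser_mult (magnus_letter l) (magnus w)"
proof (cases w)
  case (Cons l' w')
  then show ?thesis
    by (auto simp: push_letter_def magnus_letter_inv simp flip: ser_mult_assoc)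
qed (simp add: push_letter_def)

lemma magnus_mult: "magnus (foldr push_letter u v) = ser_mult (magnus u) (magnus v)"
  by (induction u) (simp_all add: magnus_push ser_mult_assoc)

lemma magnus_closed: "fst ` set w \<subseteq> {..<n} \<Longrightarrow> magnus w \<in> carrier (ser_alg n)"
proof (induction w)
  case (Cons l w)
  have "magnus_letter l \<in> carrier (ser_alg n)"
    using Cons.prems
    by (auto simp: magnus_letter_def ser_alg_def ser_one_def ser_var_def ser_geom_def split: if_splits)
  then show ?case using Cons by (simp add: ser_mult_closed)
qed (simp add: ser_alg_def ser_one_def)

lemma magnus_hom: "magnus \<in> hom (free_group n) (units_of (ser_alg n))"
proof (rule homI)
  interpret F: group "free_group n" by (rule group_free_group)
  have closed: "magnus w \<in> carrier (ser_alg n)" if "w \<in> carrier (free_group n)" for w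
    using that by (auto simp: free_group_def intro!: magnus_closed)
  have mult: "magnus (u \<otimes>\<^bsub>free_group n\<^esub> v) = magnus u \<otimes>\<^bsub>ser_alg n\<^esub> magnus v" for u v
    by (simp add: free_group_def ser_alg_def magnus_mult)
  have one: "magnus \<one>\<^bsub>free_group n\<^esub> = \<one>\<^bsub>ser_alg n\<^esub>"
    by (simp add: free_group_def ser_alg_def)
  show "magnus w \<in> carrier (units_of (ser_alg n))" if "w \<in> carrier (free_group n)" for w
    using closed[OF that] closed[OF F.inv_closed[OF that]] one
      mult[of w "inv\<^bsub>free_group n\<^esub> w"] mult[of "inv\<^bsub>free_group n\<^esub> w" w] that
    by (auto simp: units_of_def Units_def)
  show "magnus (u \<otimes>\<^bsub>free_group n\<^esub> v) = magnus u \<otimes>\<^bsub>units_of (ser_alg n)\<^esub> magnus v" for u v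
    by (simp add: mult units_of_def)
qed

lemma quot_alg_simps:
  "carrier (quot_alg A I) = carrier (A Quot I)"
  "mult (quot_alg A I) = mult (A Quot I)"
  "one (quot_alg A I) = one (A Quot I)"
  "zero (quot_alg A I) = zero (A Quot I)"
  "add (quot_alg A I) = add (A Quot I)"
  "smult (quot_alg A I) = (\<lambda>c C. \<Union>a\<in>C. I +>\<^bsub>A\<^esub> (c \<odot>\<^bsub>A\<^esub> a))"
  by (simp_all add: quot_alg_def ring.defs module.defs)

end

theory Submission
  imports Defs
begin

text \<open>
  Lift an isomorphism between the two presented groups, and its inverse, to words $u_i$ in the
  generators $y_j$ and words $v_j$ in the generators $x_i$. Substituting
  $X_i \mapsto u_i(1 + Y) - 1$ is a well-defined continuous algebra homomorphism $\Phi$ of power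
  series, since these series have no constant term, and it maps $r(1 + X)$ to $r(u)(1 + Y)$. The words
  $w$ with $w(1 + Y) - 1$ in a given ideal form a normal subgroup, so $\Phi$ maps relator series into
  the other relator ideal and hence, by continuity, closure into closure. For the analogous $\Psi$ in
  the other direction, $\Psi\Phi$ fixes every $X_i$ modulo the ideal, hence every series modulo its
  closure.
\<close>

section \<open>Substitution into power series\<close>

lemma ser_mult_sum_left: "ser_mult (\<lambda>w. \<Sum>i\<in>A. F i w) g w = (\<Sum>i\<in>A. ser_mult (F i) g w)"
  unfolding ser_mult_def sum_distrib_right by (rule sum.swap)

text \<open>The only summand of the convolution that reads \<open>f\<close> at a word as long as
  \<open>v\<close> carries the factor \<open>a []\<close>. Once this factor vanishes, only shorter
  words matter; this is what drives the inductions on length below.\<close>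

lemma ser_mult_cong:
  assumes "a [] = 0" and "\<And>u. length u < length v \<Longrightarrow> f u = g u"
  shows "ser_mult a f v = ser_mult a g v"
  unfolding ser_mult_def
proof (rule sum.cong)
  fix k assume "k \<in> {..length v}"
  then show "a (take k v) * f (drop k v) = a (take k v) * g (drop k v)"
    using assms by (cases "k = 0") auto
qed simp

lemma ser_decompose:
  assumes "f \<in> carrier (ser_alg n)"
  shows "f w = f [] * ser_one w + (\<Sum>i<n. ser_mult (ser_var i) (\<lambda>u. f (i # u)) w)"
proof (cases w)
  case (Cons x v)
  \<comment> \<open>Stripping the first letter \<open>x\<close> from a variable leaves 1 or 0, so
    only the summand with \<open>i = x\<close> survives. If \<open>x\<close> is not below
    \<open>n\<close>, no summand does, and the coefficient of \<open>f\<close> vanishes as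
    well.\<close>
  have *: "(\<lambda>u. ser_var i (x # u)) = (\<lambda>u. (if i = x then 1 else 0) * ser_one u)" for i
    by (auto simp: ser_var_def ser_one_def)
  have "(\<Sum>i<n. ser_mult (ser_var i) (\<lambda>u. f (i # u)) w) = (\<Sum>i<n. if i = x then f (x # v) else 0)"
    unfolding Cons ser_mult_Cons * ser_mult_scale_left
    by (intro sum.cong) (auto simp: ser_var_def)
  also have "\<dots> = f w"
    using assms unfolding Cons by (auto simp: ser_alg_def)
  finally show ?thesis by (simp add: Cons ser_one_def)
qed (simp add: ser_one_def ser_var_def)

text \<open>
  The series $f(\varphi_0, \ldots, \varphi_{n-1})$, read off from $f = c + \sum_i X_i f_i$, where $c$
  is the constant term of $f$ and $f_i$ is \<^term>\<open>\<lambda>u. f (i # u)\<close>. Starting at \<open>k = 1\<close> makes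
  the recursion terminate; it is correct only if the constant terms of the \<open>\<phi> i\<close> vanish.
\<close>

function ser_subst :: "nat \<Rightarrow> (nat \<Rightarrow> series) \<Rightarrow> series \<Rightarrow> series" where
  "ser_subst n \<phi> f v = f [] * ser_one v +
     (\<Sum>i<n. \<Sum>k\<in>{1..length v}. \<phi> i (take k v) * ser_subst n \<phi> (\<lambda>u. f (i # u)) (drop k v))"
  by pat_completeness auto
termination by (relation "measure (\<lambda>(_, _, _, v). length v)") auto

declare ser_subst.simps [simp del]

text \<open>The summand \<open>k = 0\<close> omitted from the recursion carries the constant term of
  \<open>\<phi> i\<close>, which is zero, so the truncated sum is a full convolution
  product.\<close>

lemma ser_subst_unfold:
  assumes "\<And>i. i < n \<Longrightarrow> \<phi> i [] = 0"
  shows "ser_subst n \<phi> f = (\<lambda>v. f [] * ser_one v +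
    (\<Sum>i<n. ser_mult (\<phi> i) (ser_subst n \<phi> (\<lambda>u. f (i # u))) v))"
proof
  fix v
  have "(\<Sum>k\<in>{1..length v}. \<phi> i (take k v) * g (drop k v)) = ser_mult (\<phi> i) g v" if "i < n" for i g
    unfolding ser_mult_def
    by (rule sum.mono_neutral_left) (use assms that in \<open>auto simp: not_less_eq_eq\<close>)
  then show "ser_subst n \<phi> f v = f [] * ser_one v +
      (\<Sum>i<n. ser_mult (\<phi> i) (ser_subst n \<phi> (\<lambda>u. f (i # u))) v)"
    by (simp add: ser_subst.simps[of n \<phi> f v])
qed

lemma ser_subst_add:
  "ser_subst n \<phi> (\<lambda>w. f w + g w) v = ser_subst n \<phi> f v + ser_subst n \<phi> g v"
proof (induction v arbitrary: f g rule: measure_induct_rule[of length])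
  case (less v)
  have "\<phi> i (take k v) * ser_subst n \<phi> (\<lambda>u. f (i # u) + g (i # u)) (drop k v) =
      \<phi> i (take k v) * ser_subst n \<phi> (\<lambda>u. f (i # u)) (drop k v) +
      \<phi> i (take k v) * ser_subst n \<phi> (\<lambda>u. g (i # u)) (drop k v)" if "k \<in> {1..length v}" for i k
    using that by (subst less) (auto simp: distrib_left)
  then show ?case
    by (simp add: ser_subst.simps[of n \<phi> _ v] sum.distrib distrib_right)
qed

lemma ser_subst_scale: "ser_subst n \<phi> (\<lambda>w. c * f w) v = c * ser_subst n \<phi> f v"
proof (induction v arbitrary: f rule: measure_induct_rule[of length])
  case (less v)
  have "(\<Sum>k\<in>{1..length v}. \<phi> i (take k v) * ser_subst n \<phi> (\<lambda>u. c * f (i # u)) (drop k v)) =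
      (\<Sum>k\<in>{1..length v}. c * (\<phi> i (take k v) * ser_subst n \<phi> (\<lambda>u. f (i # u)) (drop k v)))" for i
    by (rule sum.cong) (use less in auto)
  then show ?case
    by (simp add: ser_subst.simps[of n \<phi> _ v] distrib_left sum_distrib_left mult.assoc)
qed

lemma ser_subst_zero [simp]: "ser_subst n \<phi> (\<lambda>w. 0) v = 0"
  using ser_subst_scale[of n \<phi> 0 "\<lambda>_. 0" v] by simp

lemma ser_subst_diff:
  "ser_subst n \<phi> (\<lambda>w. f w - g w) v = ser_subst n \<phi> f v - ser_subst n \<phi> g v"
  using ser_subst_add[of n \<phi> f "\<lambda>w. - 1 * g w" v] ser_subst_scale[of n \<phi> "- 1" g v] by simp

lemma ser_subst_sum:
  "ser_subst n \<phi> (\<lambda>w. \<Sum>i\<in>A. F i w) v = (\<Sum>i\<in>A. ser_subst n \<phi> (F i) v)"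
  by (induction A rule: infinite_finite_induct) (simp_all add: ser_subst_add)

lemma ser_subst_one:
  assumes "\<And>i. i < n \<Longrightarrow> \<phi> i [] = 0"
  shows "ser_subst n \<phi> ser_one = ser_one"
proof
  fix v
  have *: "(\<lambda>u. ser_one (i # u)) = (\<lambda>u. 0)" for i
    by (simp add: ser_one_def)
  have "ser_mult h (ser_subst n \<phi> (\<lambda>u. 0)) v = 0" for h
    by (simp add: ser_mult_def)
  then show "ser_subst n \<phi> ser_one v = ser_one v"
    using assms by (subst ser_subst_unfold) (simp_all add: *, simp add: ser_one_def)
qed

text \<open>Stripping the letter \<open>i\<close> from a product gives
  \<open>f [] * g_i + f_i * g\<close>. The recursion multiplies the image of this by
  \<open>\<phi> i\<close>, which has no constant term, so multiplicativity for \<open>f_i\<close>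
  and \<open>g\<close> is used only at words shorter than \<open>v\<close>.\<close>

lemma ser_subst_mult:
  assumes \<phi>: "\<And>i. i < n \<Longrightarrow> \<phi> i [] = 0"
  shows "ser_subst n \<phi> (ser_mult f g) = ser_mult (ser_subst n \<phi> f) (ser_subst n \<phi> g)"
proof
  fix v
  show "ser_subst n \<phi> (ser_mult f g) v = ser_mult (ser_subst n \<phi> f) (ser_subst n \<phi> g) v"
  proof (induction v arbitrary: f rule: measure_induct_rule[of length])
    case (less v)
    let ?S = "ser_subst n \<phi>"
    have step: "ser_mult (\<phi> i) (?S (\<lambda>u. ser_mult f g (i # u))) v =
        f [] * ser_mult (\<phi> i) (?S (\<lambda>u. g (i # u))) v +
        ser_mult (ser_mult (\<phi> i) (?S (\<lambda>u. f (i # u)))) (?S g) v" if "i < n" for i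
    proof -
      have "ser_mult (\<phi> i) (?S (\<lambda>u. ser_mult f g (i # u))) v =
          ser_mult (\<phi> i) (\<lambda>u. f [] * ?S (\<lambda>u. g (i # u)) u + ser_mult (?S (\<lambda>u. f (i # u))) (?S g) u) v"
        by (rule ser_mult_cong)
          (use \<phi> that less in \<open>auto simp: ser_mult_Cons ser_subst_add ser_subst_scale\<close>)
      then show ?thesis
        by (simp add: ser_mult_add_right ser_mult_scale_right ser_mult_assoc)
    qed
    note unfold = ser_subst_unfold[of n \<phi>, OF \<phi>]
    have "ser_mult (?S f) (?S g) v =
        f [] * ?S g v + (\<Sum>i<n. ser_mult (ser_mult (\<phi> i) (?S (\<lambda>u. f (i # u)))) (?S g) v)"
      by (subst unfold)
        (simp_all add: ser_mult_add_left ser_mult_scale_left ser_mult_sum_left)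
    \<comment> \<open>Only the factor beside \<open>f []\<close> is expanded; inside the products
      \<open>?S g\<close> stays whole, to match the second summand of \<open>step\<close>.\<close>
    also have "?S g v = g [] * ser_one v + (\<Sum>i<n. ser_mult (\<phi> i) (?S (\<lambda>u. g (i # u))) v)"
      by (subst unfold) simp_all
    finally show ?case
      by (subst unfold) (simp_all add: step sum.distrib algebra_simps sum_distrib_left)
  qed
qed

lemma ser_subst_var:
  assumes "\<And>i. i < n \<Longrightarrow> \<phi> i [] = 0" and "j < n"
  shows "ser_subst n \<phi> (ser_var j) = \<phi> j"
proof
  fix v
  have *: "(\<lambda>u. ser_var j (i # u)) = (\<lambda>u. (if i = j then 1 else 0) * ser_one u)" for i
    by (auto simp: ser_var_def ser_one_def)
  have "ser_subst n \<phi> (\<lambda>u. c * ser_one u) = (\<lambda>u. c * ser_one u)" for c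
    using assms by (simp add: ser_subst_scale ser_subst_one fun_eq_iff)
  then have "ser_mult (\<phi> i) (ser_subst n \<phi> (\<lambda>u. ser_var j (i # u))) v = (if i = j then \<phi> j v else 0)"
    for i by (simp add: * ser_mult_scale_right)
  then show "ser_subst n \<phi> (ser_var j) v = \<phi> j v"
    using assms by (subst ser_subst_unfold) (simp_all add: ser_var_def)
qed

lemma ser_subst_closed:
  assumes "\<And>i. i < n \<Longrightarrow> \<phi> i \<in> carrier (ser_alg m)"
  shows "ser_subst n \<phi> f \<in> carrier (ser_alg m)"
proof -
  have "set v \<subseteq> {..<m}" if "ser_subst n \<phi> f v \<noteq> 0" for v
    using that
  proof (induction v arbitrary: f rule: measure_induct_rule[of length])
    case (less v)
    show ?case
    proof (cases "v = []")
      case False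
      then have "(\<Sum>i<n. \<Sum>k\<in>{1..length v}.
          \<phi> i (take k v) * ser_subst n \<phi> (\<lambda>u. f (i # u)) (drop k v)) \<noteq> 0"
        using less.prems by (simp add: ser_subst.simps[of n \<phi> f v] ser_one_def)
      then obtain i where i: "i < n" and "(\<Sum>k\<in>{1..length v}.
          \<phi> i (take k v) * ser_subst n \<phi> (\<lambda>u. f (i # u)) (drop k v)) \<noteq> 0"
        by (meson sum.neutral lessThan_iff)
      then obtain k where k: "k \<in> {1..length v}"
        and nz: "\<phi> i (take k v) * ser_subst n \<phi> (\<lambda>u. f (i # u)) (drop k v) \<noteq> 0"
        by (meson sum.neutral)
      have "set (drop k v) \<subseteq> {..<m}"
        by (rule less.IH) (use k nz in auto)
      moreover have "set (take k v) \<subseteq> {..<m}"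
        using assms[OF i] nz by (auto simp: ser_alg_def)
      ultimately show ?thesis by (metis Un_least append_take_drop_id set_append)
    qed simp
  qed
  then show ?thesis by (simp add: ser_alg_def)
qed

text \<open>Each step of the recursion consumes at least one letter of \<open>v\<close>, so
  \<open>f\<close> is read only at words of length at most \<open>length v\<close>. This is the
  continuity of the substitution.\<close>

lemma ser_subst_local:
  assumes "\<And>w. length w \<le> length v \<Longrightarrow> f w = g w"
  shows "ser_subst n \<phi> f v = ser_subst n \<phi> g v"
  using assms
proof (induction v arbitrary: f g rule: measure_induct_rule[of length])
  case (less v)
  have "ser_subst n \<phi> (\<lambda>u. f (i # u)) (drop k v) = ser_subst n \<phi> (\<lambda>u. g (i # u)) (drop k v)"
    if "k \<in> {1..length v}" for i k
    by (rule less.IH) (use that in \<open>auto intro!: less.prems\<close>)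
  then show ?case
    using less.prems[of "[]"] by (simp add: ser_subst.simps[of n \<phi> _ v])
qed

section \<open>Magnus expansions of words under substitution\<close>

lemma magnus_Nil_coeff [simp]: "magnus w [] = 1"
  by (induction w) (simp_all add: magnus_letter_def ser_one_def ser_var_def ser_geom_def)

lemma relator_series_Nil_coeff [simp]: "relator_series w [] = 0"
  by (simp add: relator_series_def ser_one_def)

text \<open>The homomorphism of free groups sending the generator with index \<open>i\<close> to
  \<open>u i\<close>. The fold over letters mirrors \<open>magnus\<close>, so the two can be
  compared letter by letter.\<close>

definition word_subst :: "nat \<Rightarrow> (nat \<Rightarrow> letter list) \<Rightarrow> letter list \<Rightarrow> letter list" where
  "word_subst m u w = foldr (\<lambda>l x. (if snd l then u (fst l)
     else inv\<^bsub>free_group m\<^esub> u (fst l)) \<otimes>\<^bsub>free_group m\<^esub> x) w \<one>\<^bsub>free_group m\<^esub>"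

lemma word_subst_closed:
  assumes "\<And>i. i < n \<Longrightarrow> u i \<in> carrier (free_group m)" and "fst ` set w \<subseteq> {..<n}"
  shows "word_subst m u w \<in> carrier (free_group m)"
proof -
  interpret F: group "free_group m" by (rule group_free_group)
  show ?thesis
    using assms(2) by (induction w) (auto simp: word_subst_def assms(1))
qed

lemma magnus_free_mult: "magnus (u \<otimes>\<^bsub>free_group n\<^esub> v) = ser_mult (magnus u) (magnus v)"
  by (simp add: free_group_def magnus_mult)

lemma magnus_free_one: "magnus \<one>\<^bsub>free_group n\<^esub> = ser_one"
  by (simp add: free_group_def)

lemma magnus_inv:
  assumes "w \<in> carrier (free_group n)"
  shows "ser_mult (magnus w) (magnus (inv\<^bsub>free_group n\<^esub> w)) = ser_one"
    and "ser_mult (magnus (inv\<^bsub>free_group n\<^esub> w)) (magnus w) = ser_one"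
proof -
  interpret F: group "free_group n" by (rule group_free_group)
  show "ser_mult (magnus w) (magnus (inv\<^bsub>free_group n\<^esub> w)) = ser_one"
    and "ser_mult (magnus (inv\<^bsub>free_group n\<^esub> w)) (magnus w) = ser_one"
    using assms magnus_free_mult[of n w "inv\<^bsub>free_group n\<^esub> w"]
      magnus_free_mult[of n "inv\<^bsub>free_group n\<^esub> w" w] by (simp_all add: magnus_free_one)
qed

text \<open>By multiplicativity it suffices to compare letters. The series 1 + X_i goes to
  \<open>magnus (u i)\<close>; the geometric series is a left inverse of it, so its image is a left
  inverse of the unit \<open>magnus (u i)\<close> and must be the expansion of the inverse
  word.\<close>

lemma ser_subst_magnus:
  assumes u: "\<And>i. i < n \<Longrightarrow> u i \<in> carrier (free_group m)" and "fst ` set w \<subseteq> {..<n}"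
  shows "ser_subst n (\<lambda>i. relator_series (u i)) (magnus w) = magnus (word_subst m u w)"
proof -
  interpret F: group "free_group m" by (rule group_free_group)
  let ?S = "ser_subst n (\<lambda>i. relator_series (u i))"
  have pos: "?S (\<lambda>w. ser_one w + ser_var i w) = magnus (u i)" if "i < n" for i
  proof
    fix v
    show "?S (\<lambda>w. ser_one w + ser_var i w) v = magnus (u i) v"
      by (simp add: ser_subst_add ser_subst_one ser_subst_var that)
        (simp add: relator_series_def)
  qed
  have neg: "?S (ser_geom i) = magnus (inv\<^bsub>free_group m\<^esub> u i)" if "i < n" for i
  proof -
    have "ser_mult (?S (ser_geom i)) (magnus (u i)) = ser_one"
      using ser_subst_mult[of n "\<lambda>i. relator_series (u i)" "ser_geom i" "\<lambda>w. ser_one w + ser_var i w"]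
      by (simp add: ser_geom_left pos that ser_subst_one)
    then have "ser_mult (?S (ser_geom i)) (ser_mult (magnus (u i)) (magnus (inv\<^bsub>free_group m\<^esub> u i))) =
        magnus (inv\<^bsub>free_group m\<^esub> u i)"
      by (simp flip: ser_mult_assoc)
    then show ?thesis by (simp add: magnus_inv[OF u[OF that]])
  qed
  show ?thesis
    using assms(2)
  proof (induction w)
    case (Cons l w)
    then have "?S (magnus_letter l) = magnus (if snd l then u (fst l) else inv\<^bsub>free_group m\<^esub> u (fst l))"
      by (auto simp: magnus_letter_def pos neg)
    with Cons show ?case
      by (simp add: ser_subst_mult word_subst_def magnus_free_mult)
  qed (simp add: word_subst_def ser_subst_one magnus_free_one)
qed

section \<open>Closed ideals of power series\<close>

lemma ser_alg_simps:
  "mult (ser_alg n) = ser_mult" "one (ser_alg n) = ser_one" "zero (ser_alg n) = (\<lambda>w. 0)"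
  "add (ser_alg n) = (\<lambda>f g w. f w + g w)" "smult (ser_alg n) = (\<lambda>c f w. c * f w)"
  by (simp_all add: ser_alg_def)

lemma ser_scale_closed: "f \<in> carrier (ser_alg n) \<Longrightarrow> (\<lambda>w. c * f w) \<in> carrier (ser_alg n)"
  by (simp add: ser_alg_def)

lemma ser_alg_a_inv:
  assumes "f \<in> carrier (ser_alg n)"
  shows "\<ominus>\<^bsub>ser_alg n\<^esub> f = (\<lambda>w. - f w)"
proof -
  interpret R: ring "ser_alg n" by (rule ring_ser_alg)
  show ?thesis
    by (rule R.minus_equality) (use assms ser_scale_closed[OF assms, of "- 1"] in \<open>auto simp: ser_alg_simps\<close>)
qed

lemma ser_alg_minus:
  assumes "f \<in> carrier (ser_alg n)" "g \<in> carrier (ser_alg n)"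
  shows "f \<ominus>\<^bsub>ser_alg n\<^esub> g = (\<lambda>w. f w - g w)"
  using assms by (simp add: a_minus_def ser_alg_a_inv ser_alg_simps)

lemma ser_diff_closed:
  assumes "f \<in> carrier (ser_alg n)" "g \<in> carrier (ser_alg n)"
  shows "(\<lambda>w. f w - g w) \<in> carrier (ser_alg n)"
  using ring.ring_simprules(4)[OF ring_ser_alg assms] by (simp add: ser_alg_minus assms)

lemma ser_one_closed: "ser_one \<in> carrier (ser_alg n)"
  by (simp add: ser_alg_def ser_one_def)

lemma ser_var_closed: "i < n \<Longrightarrow> ser_var i \<in> carrier (ser_alg n)"
  by (simp add: ser_alg_def ser_var_def)

lemma relator_series_closed:
  "w \<in> carrier (free_group n) \<Longrightarrow> relator_series w \<in> carrier (ser_alg n)"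
  unfolding relator_series_def
  by (intro ser_diff_closed magnus_closed ser_one_closed) (simp add: free_group_def)

lemma ser_mult_diff_left: "ser_mult (\<lambda>w. f w - g w) h = (\<lambda>w. ser_mult f h w - ser_mult g h w)"
  by (simp add: fun_eq_iff ser_mult_def sum_subtractf left_diff_distrib)

lemma ser_mult_diff_right: "ser_mult h (\<lambda>w. f w - g w) = (\<lambda>w. ser_mult h f w - ser_mult h g w)"
  by (simp add: fun_eq_iff ser_mult_def sum_subtractf right_diff_distrib)

lemma ser_mult_local:
  assumes "\<And>w. length w < N \<Longrightarrow> f w = f' w" and "\<And>w. length w < N \<Longrightarrow> g w = g' w"
    and "length w < N"
  shows "ser_mult f g w = ser_mult f' g' w"
  unfolding ser_mult_def by (rule sum.cong) (use assms in auto)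

text \<open>Serves to restate the ideal laws for coefficient functions, the form in which series are
  computed with here.\<close>

locale ser_ideal =
  fixes n :: nat and I :: "series set"
  assumes ideal: "ideal I (ser_alg n)"
begin

sublocale ideal I "ser_alg n"
  by (rule ideal)

lemma zero: "(\<lambda>w. 0) \<in> I"
  using additive_subgroup.zero_closed[OF is_additive_subgroup] by (simp add: ser_alg_simps)

lemma add: "f \<in> I \<Longrightarrow> g \<in> I \<Longrightarrow> (\<lambda>w. f w + g w) \<in> I"
  using additive_subgroup.a_closed[OF is_additive_subgroup, of f g] by (simp add: ser_alg_simps)

lemma sum: "(\<And>i. i \<in> A \<Longrightarrow> F i \<in> I) \<Longrightarrow> (\<lambda>w. \<Sum>i\<in>A. F i w) \<in> I"
  by (induction A rule: infinite_finite_induct) (simp_all add: zero add)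

lemma mult_left: "f \<in> I \<Longrightarrow> g \<in> carrier (ser_alg n) \<Longrightarrow> ser_mult g f \<in> I"
  using I_l_closed[of f g] by (simp add: ser_alg_simps)

lemma mult_right: "f \<in> I \<Longrightarrow> g \<in> carrier (ser_alg n) \<Longrightarrow> ser_mult f g \<in> I"
  using I_r_closed[of f g] by (simp add: ser_alg_simps)

text \<open>Ring ideals carry no scalar action by definition; multiplying by \<open>c\<close> is
  multiplying by the constant series \<open>c\<close>.\<close>

lemma scale:
  assumes "f \<in> I"
  shows "(\<lambda>w. c * f w) \<in> I"
proof -
  have "ser_mult (\<lambda>w. c * ser_one w) f = (\<lambda>w. c * f w)"
    by (simp add: ser_mult_scale_left fun_eq_iff)
  then show ?thesis
    using mult_left[OF assms ser_scale_closed[OF ser_one_closed, of c]] by simp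
qed

end

text \<open>Closure in terms of degrees: elements of \<open>I\<close> approximate \<open>f\<close>
  below every degree. This avoids open sets in all later arguments.\<close>

definition ser_closure :: "nat \<Rightarrow> series set \<Rightarrow> series set" where
  "ser_closure n I =
     {f \<in> carrier (ser_alg n). \<forall>N. \<exists>g\<in>I. \<forall>w. length w < N \<longrightarrow> f w = g w}"

lemma ser_closureE:
  assumes "f \<in> ser_closure n I"
  obtains g where "g \<in> I" "\<And>w. length w < N \<Longrightarrow> f w = g w"
  using assms unfolding ser_closure_def by blast

text \<open>In finitely many variables there are finitely many words of bounded length, so agreement
  below a degree is an open condition. Conversely, a basic open set restricts only finitely many
  coefficients, whose words have bounded length.\<close>

lemma closure_of_ser_topology:
  assumes "I \<subseteq> carrier (ser_alg n)"
  shows "Abstract_Topology.closure_of (ser_topology n) I = ser_closure n I"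
proof (intro equalityI subsetI)
  let ?P = "product_topology (\<lambda>_::nat list. discrete_topology (UNIV :: rat set)) UNIV"
  have top: "topspace (ser_topology n) = carrier (ser_alg n)"
    by (simp add: ser_topology_def)
  {
    fix f assume "f \<in> Abstract_Topology.closure_of (ser_topology n) I"
    then have f: "f \<in> carrier (ser_alg n)"
      and cl: "\<And>T. f \<in> T \<Longrightarrow> openin (ser_topology n) T \<Longrightarrow> \<exists>g\<in>I. g \<in> T"
      by (auto simp: in_closure_of top)
    have "\<exists>g\<in>I. \<forall>w. length w < N \<longrightarrow> f w = g w" for N
    proof -
      define W where "W = {w. set w \<subseteq> {..<n} \<and> length w \<le> N}"
      define T where "T = PiE UNIV (\<lambda>w. if w \<in> W then {f w} else UNIV)"
      have "finite W"
        unfolding W_def by (rule finite_lists_length_le) simp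
      then have "openin ?P T"
        unfolding T_def by (intro openin_PiE_gen[THEN iffD2] disjI2) (auto intro: finite_subset[of _ W])
      then have "openin (ser_topology n) (T \<inter> carrier (ser_alg n))"
        by (auto simp: ser_topology_def openin_subtopology)
      moreover have "f \<in> T \<inter> carrier (ser_alg n)"
        using f by (simp add: T_def PiE_iff)
      ultimately obtain g where g: "g \<in> I" "g \<in> T"
        using cl by blast
      have "f w = g w" if "length w < N" for w
      proof (cases "w \<in> W")
        case True
        then show ?thesis using g(2) by (auto simp: T_def PiE_iff split: if_splits)
      next
        \<comment> \<open>The set \<open>T\<close> leaves this coefficient free, but the word uses
          an index outside \<open>{..<n}\<close>, where both series vanish.\<close>
        case False
        then have "\<not> set w \<subseteq> {..<n}" using that by (simp add: W_def)
        moreover have "g \<in> carrier (ser_alg n)" using g(1) assms by blast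
        ultimately have "f w = 0" "g w = 0"
          using f unfolding ser_alg_def by fastforce+
        then show ?thesis by simp
      qed
      with g(1) show ?thesis by blast
    qed
    with f show "f \<in> ser_closure n I" by (simp add: ser_closure_def)
  next
    fix f assume f: "f \<in> ser_closure n I"
    have "\<exists>g. g \<in> I \<and> g \<in> T" if T: "f \<in> T" "openin (ser_topology n) T" for T
    proof -
      obtain S where S: "openin ?P S" "T = S \<inter> carrier (ser_alg n)"
        using T(2) by (auto simp: ser_topology_def openin_subtopology)
      then obtain U where U: "finite {w. U w \<noteq> (UNIV :: rat set)}" "f \<in> PiE UNIV U" "PiE UNIV U \<subseteq> S"
        using T(1) by (auto simp: openin_product_topology_alt)
      obtain N where N: "\<And>w. U w \<noteq> UNIV \<Longrightarrow> length w < N"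
        using finite_imageI[OF U(1), of length] unfolding finite_nat_set_iff_bounded by auto
      obtain g where g: "g \<in> I" "\<And>w. length w < N \<Longrightarrow> f w = g w"
        using ser_closureE[OF f, where N = N] by blast
      have "g w \<in> U w" for w
      proof (cases "U w = UNIV")
        case False
        then have "f w = g w" by (intro g(2) N)
        moreover have "f w \<in> U w" using U(2) by (simp add: PiE_iff)
        ultimately show ?thesis by simp
      qed simp
      then have "g \<in> S" using U(3) by (auto simp: PiE_iff)
      then show ?thesis
        using g(1) assms S(2) by blast
    qed
    then show "f \<in> Abstract_Topology.closure_of (ser_topology n) I"
      using f by (auto simp: in_closure_of top ser_closure_def)
  }
qed

text \<open>Approximants in \<open>I\<close> are combined by the same operation. For products this
  works because coefficients below degree \<open>N\<close> depend only on the coefficients of the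
  factors below degree \<open>N\<close>.\<close>

lemma (in ser_ideal) ideal_closure: "ideal (ser_closure n I) (ser_alg n)"
proof (rule idealI)
  show "ring (ser_alg n)" by (rule ring_ser_alg)
  show "subgroup (ser_closure n I) (add_monoid (ser_alg n))"
  proof
    show "ser_closure n I \<subseteq> carrier (add_monoid (ser_alg n))"
      by (auto simp: ser_closure_def)
    show "\<one>\<^bsub>add_monoid (ser_alg n)\<^esub> \<in> ser_closure n I"
      using zero by (auto simp: ser_closure_def ser_alg_def)
  next
    fix f g assume fg: "f \<in> ser_closure n I" "g \<in> ser_closure n I"
    have "\<exists>h\<in>I. \<forall>w. length w < N \<longrightarrow> f w + g w = h w" for N
    proof -
      obtain f' where f': "f' \<in> I" "\<And>w. length w < N \<Longrightarrow> f w = f' w"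
        using ser_closureE[OF fg(1), where N = N] by blast
      obtain g' where "g' \<in> I" "\<And>w. length w < N \<Longrightarrow> g w = g' w"
        using ser_closureE[OF fg(2), where N = N] by blast
      with f' show ?thesis by (intro bexI[OF _ add[of f' g']]) auto
    qed
    moreover have "f \<oplus>\<^bsub>ser_alg n\<^esub> g \<in> carrier (ser_alg n)"
      using fg by (intro ring.ring_simprules(1)[OF ring_ser_alg]) (simp_all add: ser_closure_def)
    ultimately show "f \<otimes>\<^bsub>add_monoid (ser_alg n)\<^esub> g \<in> ser_closure n I"
      by (simp add: ser_closure_def ser_alg_simps)
  next
    fix f assume f: "f \<in> ser_closure n I"
    then have "f \<in> carrier (ser_alg n)" by (simp add: ser_closure_def)
    then have "inv\<^bsub>add_monoid (ser_alg n)\<^esub> f = (\<lambda>w. - 1 * f w)"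
      by (simp add: ser_alg_a_inv flip: a_inv_def)
    moreover have "\<exists>h\<in>I. \<forall>w. length w < N \<longrightarrow> - 1 * f w = h w" for N
    proof -
      obtain f' where "f' \<in> I" "\<And>w. length w < N \<Longrightarrow> f w = f' w"
        using ser_closureE[OF f, where N = N] by blast
      then show ?thesis by (intro bexI[OF _ scale[of f' "- 1"]]) auto
    qed
    ultimately show "inv\<^bsub>add_monoid (ser_alg n)\<^esub> f \<in> ser_closure n I"
      using f ser_scale_closed[of f n "- 1"] by (simp add: ser_closure_def)
  qed
next
  fix f a assume f: "f \<in> ser_closure n I" and a: "a \<in> carrier (ser_alg n)"
  have "\<exists>h\<in>I. \<forall>w. length w < N \<longrightarrow> ser_mult a f w = h w"
    "\<exists>h\<in>I. \<forall>w. length w < N \<longrightarrow> ser_mult f a w = h w" for N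
  proof -
    obtain f' where f': "f' \<in> I" "\<And>w. length w < N \<Longrightarrow> f w = f' w"
      using ser_closureE[OF f, where N = N] by blast
    show "\<exists>h\<in>I. \<forall>w. length w < N \<longrightarrow> ser_mult a f w = h w"
      by (intro bexI[OF _ mult_left[OF f'(1) a]] allI impI ser_mult_local f'(2)) auto
    show "\<exists>h\<in>I. \<forall>w. length w < N \<longrightarrow> ser_mult f a w = h w"
      by (intro bexI[OF _ mult_right[OF f'(1) a]] allI impI ser_mult_local f'(2)) auto
  qed
  then show "a \<otimes>\<^bsub>ser_alg n\<^esub> f \<in> ser_closure n I" "f \<otimes>\<^bsub>ser_alg n\<^esub> a \<in> ser_closure n I"
    using f a ser_mult_closed[of f n a] ser_mult_closed[of a n f]
    by (simp_all add: ser_closure_def ser_alg_simps)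
qed

section \<open>Words and substitutions modulo an ideal\<close>

context ser_ideal
begin

text \<open>This is the kernel of the map from words to units modulo \<open>I\<close>. Writing words
  for their expansions, the closure properties come from w^-1 - 1 = -w^-1 (w - 1), uv - 1 = (u - 1)
  v + (v - 1) and x h x^-1 - 1 = x (h - 1) x^-1.\<close>

lemma normal_relators: "{w \<in> carrier (free_group n). relator_series w \<in> I} \<lhd> free_group n"
proof -
  interpret F: group "free_group n" by (rule group_free_group)
  let ?K = "{w \<in> carrier (free_group n). relator_series w \<in> I}"
  have closed: "magnus w \<in> carrier (ser_alg n)" if "w \<in> carrier (free_group n)" for w
    using that by (intro magnus_closed) (simp add: free_group_def)
  show ?thesis
  proof (rule F.normal_invI, rule F.subgroupI)
    show "?K \<noteq> {}"
      using zero by (auto intro!: exI[of _ "\<one>\<^bsub>free_group n\<^esub>"] simp: relator_series_def magnus_free_one)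
  next
    fix w assume w: "w \<in> ?K"
    have "relator_series (inv\<^bsub>free_group n\<^esub> w) =
        (\<lambda>v. - 1 * ser_mult (magnus (inv\<^bsub>free_group n\<^esub> w)) (relator_series w) v)"
      using w by (simp add: relator_series_def ser_mult_diff_right magnus_inv fun_eq_iff)
    also have "\<dots> \<in> I"
      using w by (intro scale mult_left closed) auto
    finally show "inv\<^bsub>free_group n\<^esub> w \<in> ?K" using w by simp
  next
    fix u v assume uv: "u \<in> ?K" "v \<in> ?K"
    have "relator_series (u \<otimes>\<^bsub>free_group n\<^esub> v) =
        (\<lambda>w. ser_mult (relator_series u) (magnus v) w + relator_series v w)"
      by (simp add: relator_series_def ser_mult_diff_left magnus_free_mult fun_eq_iff)
    also have "\<dots> \<in> I"
      using uv by (intro add mult_right closed) auto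
    finally show "u \<otimes>\<^bsub>free_group n\<^esub> v \<in> ?K" using uv by simp
  next
    fix x h assume x: "x \<in> carrier (free_group n)" and h: "h \<in> ?K"
    have "relator_series (x \<otimes>\<^bsub>free_group n\<^esub> h \<otimes>\<^bsub>free_group n\<^esub> inv\<^bsub>free_group n\<^esub> x) =
        ser_mult (ser_mult (magnus x) (relator_series h)) (magnus (inv\<^bsub>free_group n\<^esub> x))"
      by (simp add: relator_series_def ser_mult_diff_left ser_mult_diff_right magnus_free_mult
          magnus_inv[OF x] fun_eq_iff ser_mult_assoc)
    also have "\<dots> \<in> I"
      using x h by (intro mult_right mult_left closed) auto
    finally show "x \<otimes>\<^bsub>free_group n\<^esub> h \<otimes>\<^bsub>free_group n\<^esub> inv\<^bsub>free_group n\<^esub> x \<in> ?K" using x h by simp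
  qed auto
qed

text \<open>The normal subgroup of \<open>normal_relators\<close> contains \<open>S\<close>, so it
  is one of the subgroups intersected in the normal closure.\<close>

lemma relator_series_normal_closure:
  assumes "S \<subseteq> carrier (free_group n)" "relator_series ` S \<subseteq> I"
    and "w \<in> normal_closure (free_group n) S"
  shows "relator_series w \<in> I"
  using assms normal_relators unfolding normal_closure_def by blast

text \<open>With d = u v^-1, the difference of the expansions factors as (d - 1) v, and d - 1 lies
  in \<open>I\<close>.\<close>

lemma magnus_diff_mem:
  assumes "S \<subseteq> carrier (free_group n)" "relator_series ` S \<subseteq> I"
    and u: "u \<in> carrier (free_group n)" and v: "v \<in> carrier (free_group n)"
    and "u \<otimes>\<^bsub>free_group n\<^esub> inv\<^bsub>free_group n\<^esub> v \<in> normal_closure (free_group n) S"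
  shows "(\<lambda>w. magnus u w - magnus v w) \<in> I"
proof -
  interpret F: group "free_group n" by (rule group_free_group)
  let ?d = "u \<otimes>\<^bsub>free_group n\<^esub> inv\<^bsub>free_group n\<^esub> v"
  have "?d \<otimes>\<^bsub>free_group n\<^esub> v = u"
    using u v by (simp add: F.m_assoc)
  then have "ser_mult (magnus ?d) (magnus v) = magnus u"
    by (metis magnus_free_mult)
  then have "(\<lambda>w. magnus u w - magnus v w) = ser_mult (relator_series ?d) (magnus v)"
    by (simp add: relator_series_def ser_mult_diff_left fun_eq_iff)
  also have "\<dots> \<in> I"
    using v by (intro mult_right relator_series_normal_closure[OF assms(1,2,5)] magnus_closed)
      (simp add: free_group_def)
  finally show ?thesis .
qed

text \<open>
  Write \<open>\<theta>\<close> for the composite substitution. From $f = c + \sum_i X_i f_i$ one gets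
  $\theta f - f = \sum_i (\theta X_i - X_i)\, \theta f_i + X_i\, (\theta f_i - f_i)$, so each step of
  the induction gains one degree of precision modulo \<open>I\<close>.
\<close>

lemma ser_subst_close:
  assumes \<phi>: "\<And>i. i < n \<Longrightarrow> \<phi> i \<in> carrier (ser_alg m)" "\<And>i. i < n \<Longrightarrow> \<phi> i [] = 0"
    and \<psi>: "\<And>j. j < m \<Longrightarrow> \<psi> j \<in> carrier (ser_alg n)" "\<And>j. j < m \<Longrightarrow> \<psi> j [] = 0"
    and close: "\<And>i. i < n \<Longrightarrow> (\<lambda>w. ser_subst m \<psi> (\<phi> i) w - ser_var i w) \<in> I"
    and f: "f \<in> carrier (ser_alg n)"
  shows "(\<lambda>w. ser_subst m \<psi> (ser_subst n \<phi> f) w - f w) \<in> ser_closure n I"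
proof -
  let ?T = "\<lambda>f. ser_subst m \<psi> (ser_subst n \<phi> f)"
  let ?\<theta> = "\<lambda>i. ser_subst m \<psi> (\<phi> i)"
  have T_closed: "?T f \<in> carrier (ser_alg n)" for f
    by (rule ser_subst_closed) (rule \<psi>)
  \<comment> \<open>The outer substitution is a homomorphism, so the first-letter recursion of the
    inner one carries over to the composite.\<close>
  have T: "?T f w = f [] * ser_one w + (\<Sum>i<n. ser_mult (?\<theta> i) (?T (\<lambda>u. f (i # u))) w)" for f w
  proof -
    have "?T f = ser_subst m \<psi> (\<lambda>v. f [] * ser_one v +
        (\<Sum>i<n. ser_mult (\<phi> i) (ser_subst n \<phi> (\<lambda>u. f (i # u))) v))"
      by (subst ser_subst_unfold[of n \<phi>, OF \<phi>(2)]) simp_all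
    then show ?thesis
      by (simp add: ser_subst_add ser_subst_scale ser_subst_sum ser_subst_one ser_subst_mult \<psi>(2))
  qed
  have "\<exists>g\<in>I. \<forall>w. length w < N \<longrightarrow> ?T f w - f w = g w" for N
    using f
  proof (induction N arbitrary: f)
    case 0
    show ?case using zero by auto
  next
    case (Suc N)
    have "(\<lambda>u. f (i # u)) \<in> carrier (ser_alg n)" for i
      using Suc.prems by (force simp: ser_alg_def)
    then have "\<exists>g\<in>I. \<forall>w. length w < N \<longrightarrow> ?T (\<lambda>u. f (i # u)) w - f (i # w) = g w" for i
      by (rule Suc.IH)
    then obtain g where g: "\<And>i. g i \<in> I"
      "\<And>i w. length w < N \<Longrightarrow> ?T (\<lambda>u. f (i # u)) w - f (i # w) = g i w"
      by metis
    \<comment> \<open>The expression for \<theta> f - f with each difference \<theta> f_i - f_i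
      replaced by its approximant \<open>g i\<close> from \<open>I\<close>.\<close>
    define h where "h = (\<lambda>w. \<Sum>i<n.
      ser_mult (\<lambda>w. ?\<theta> i w - ser_var i w) (?T (\<lambda>u. f (i # u))) w + ser_mult (ser_var i) (g i) w)"
    have "h \<in> I"
      unfolding h_def by (intro sum add mult_right mult_left close g(1) T_closed ser_var_closed) auto
    moreover have "?T f w - f w = h w" if "length w < Suc N" for w
    proof -
      \<comment> \<open>A variable has no constant term, so at a word of length at most
        \<open>N\<close> the product reads \<open>g i\<close> only at lengths below
        \<open>N\<close>, where the approximation holds.\<close>
      have "ser_mult (ser_var i) (g i) w =
          ser_mult (ser_var i) (\<lambda>w. ?T (\<lambda>u. f (i # u)) w - f (i # w)) w" for i
        by (rule ser_mult_cong) (use that g(2) in \<open>auto simp: ser_var_def\<close>)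
      then show ?thesis
        by (subst T, subst (3) ser_decompose[OF Suc.prems])
          (simp add: h_def ser_mult_diff_left ser_mult_diff_right sum_subtractf)
    qed
    ultimately show ?case by blast
  qed
  then show ?thesis
    using f by (auto simp: ser_closure_def intro!: ser_diff_closed T_closed)
qed

end

section \<open>Isomorphisms of quotient algebras\<close>

text \<open>Ring isomorphisms inspect only the ring fields, which \<open>quot_alg\<close> takes over
  from \<open>Quot\<close>; this gives access to the first isomorphism theorem.\<close>

lemma ring_iso_quot_alg:
  "ring_iso (quot_alg A I) (quot_alg B J) = ring_iso (A Quot I) (B Quot J)"
  by (simp add: ring_iso_def ring_hom_def quot_alg_simps)

text \<open>By \<open>diff\<close>, all representatives of a coset have scalar multiples in one
  coset, so the union defining the scalar action collapses to it.\<close>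

lemma smult_quot_alg:
  assumes "ideal I A" and a: "a \<in> carrier A"
    and closed: "\<And>c a. a \<in> carrier A \<Longrightarrow> c \<odot>\<^bsub>A\<^esub> a \<in> carrier A"
    and diff: "\<And>c a b. a \<in> carrier A \<Longrightarrow> b \<in> carrier A \<Longrightarrow> a \<ominus>\<^bsub>A\<^esub> b \<in> I \<Longrightarrow>
      c \<odot>\<^bsub>A\<^esub> a \<ominus>\<^bsub>A\<^esub> c \<odot>\<^bsub>A\<^esub> b \<in> I"
  shows "c \<odot>\<^bsub>quot_alg A I\<^esub> (I +>\<^bsub>A\<^esub> a) = I +>\<^bsub>A\<^esub> (c \<odot>\<^bsub>A\<^esub> a)"
proof -
  interpret ideal I A by fact
  have "I +>\<^bsub>A\<^esub> (c \<odot>\<^bsub>A\<^esub> b) = I +>\<^bsub>A\<^esub> (c \<odot>\<^bsub>A\<^esub> a)" if b: "b \<in> I +>\<^bsub>A\<^esub> a" for b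
  proof -
    have bc: "b \<in> carrier A" and "I +>\<^bsub>A\<^esub> b = I +>\<^bsub>A\<^esub> a"
      using a b a_r_coset_subset_G[OF a_subset a] a_repr_independence[OF b a a_subgroup] by auto
    then show ?thesis
      using quotient_eq_iff_same_a_r_cos[OF ideal_axioms] diff[OF bc a] closed a by metis
  qed
  moreover have "I +>\<^bsub>A\<^esub> a \<noteq> {}" using a_rcos_self[OF a] by blast
  ultimately show ?thesis
    unfolding quot_alg_simps by (intro SUP_eq_const)
qed

text \<open>The first isomorphism theorem is applied to \<open>h\<close> followed by the projection
  onto \<open>B Quot J\<close>. The map \<open>k\<close>, inverse to \<open>h\<close> modulo the
  ideals, shows that the kernel is no larger than \<open>I\<close> and that the composite is
  onto.\<close>

lemma is_alg_iso_quot_algI: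
  assumes I: "ideal I A" and J: "ideal J B"
    and h: "h \<in> ring_hom A B" and k: "k \<in> ring_hom B A"
    and hI: "h ` I \<subseteq> J" and kJ: "k ` J \<subseteq> I"
    and kh: "\<And>a. a \<in> carrier A \<Longrightarrow> k (h a) \<ominus>\<^bsub>A\<^esub> a \<in> I"
    and hk: "\<And>b. b \<in> carrier B \<Longrightarrow> h (k b) \<ominus>\<^bsub>B\<^esub> b \<in> J"
    and smult: "\<And>c a. a \<in> carrier A \<Longrightarrow> h (c \<odot>\<^bsub>A\<^esub> a) = c \<odot>\<^bsub>B\<^esub> h a"
    and closed: "\<And>c a. a \<in> carrier A \<Longrightarrow> c \<odot>\<^bsub>A\<^esub> a \<in> carrier A"
      "\<And>c b. b \<in> carrier B \<Longrightarrow> c \<odot>\<^bsub>B\<^esub> b \<in> carrier B"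
    and diff: "\<And>c a b. a \<in> carrier A \<Longrightarrow> b \<in> carrier A \<Longrightarrow> a \<ominus>\<^bsub>A\<^esub> b \<in> I \<Longrightarrow>
      c \<odot>\<^bsub>A\<^esub> a \<ominus>\<^bsub>A\<^esub> c \<odot>\<^bsub>A\<^esub> b \<in> I"
      "\<And>c a b. a \<in> carrier B \<Longrightarrow> b \<in> carrier B \<Longrightarrow> a \<ominus>\<^bsub>B\<^esub> b \<in> J \<Longrightarrow>
      c \<odot>\<^bsub>B\<^esub> a \<ominus>\<^bsub>B\<^esub> c \<odot>\<^bsub>B\<^esub> b \<in> J"
  shows "is_alg_iso (quot_alg A I) (quot_alg B J)"
proof -
  interpret I: ideal I A by fact
  interpret J: ideal J B by fact
  define p where "p = (\<lambda>a. J +>\<^bsub>B\<^esub> h a)"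
  have hc: "h a \<in> carrier B" if "a \<in> carrier A" for a
    using h that by (rule ring_hom_closed)
  have kc: "k b \<in> carrier A" if "b \<in> carrier B" for b
    using k that by (rule ring_hom_closed)
  have mem_iff: "J +>\<^bsub>B\<^esub> b = J \<longleftrightarrow> b \<in> J" if "b \<in> carrier B" for b
    using J.a_rcos_self[OF that] J.a_rcos_const[of b] by auto
  have "p \<in> ring_hom A (B Quot J)"
    using ring_hom_trans[OF h J.rcos_ring_hom] by (simp add: comp_def p_def)
  then interpret P: ring_hom_ring A "B Quot J" p
    by (rule ring_hom_ringI2[OF I.ring_axioms J.quotient_is_ring])
  have ker_eq: "a_kernel A (B Quot J) p = {a \<in> carrier A. J +>\<^bsub>B\<^esub> h a = J}"
    by (simp add: a_kernel_def' FactRing_def p_def)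
  have ker: "a_kernel A (B Quot J) p = I"
  proof (intro equalityI subsetI)
    fix a assume "a \<in> a_kernel A (B Quot J) p"
    then have a: "a \<in> carrier A" and "J +>\<^bsub>B\<^esub> h a = J"
      unfolding ker_eq by blast+
    then have "h a \<in> J"
      using mem_iff[OF hc[OF a]] by blast
    \<comment> \<open>Since \<open>k\<close> maps \<open>J\<close> into \<open>I\<close>, the
      element \<open>k (h a)\<close> lies in \<open>I\<close>; it is congruent to \<open>a\<close>,
      so \<open>a\<close> lies in \<open>I\<close> too.\<close>
    then have "I +>\<^bsub>A\<^esub> k (h a) = I"
      using kJ by (intro I.a_rcos_const) blast
    moreover have "I +>\<^bsub>A\<^esub> k (h a) = I +>\<^bsub>A\<^esub> a"
      using kh[OF a] I.quotient_eq_iff_same_a_r_cos[OF I kc[OF hc[OF a]] a] by simp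
    ultimately show "a \<in> I"
      using I.a_rcos_self[OF a] by simp
  next
    fix a assume "a \<in> I"
    then show "a \<in> a_kernel A (B Quot J) p"
      unfolding ker_eq using hI mem_iff[OF hc[OF I.Icarr[of a]]] I.Icarr[of a] by blast
  qed
  have "p ` carrier A = carrier (B Quot J)"
  proof (intro equalityI subsetI)
    fix C assume "C \<in> carrier (B Quot J)"
    then obtain b where b: "b \<in> carrier B" "C = J +>\<^bsub>B\<^esub> b"
      by (auto simp: FactRing_def A_RCOSETS_def')
    then have "p (k b) = C"
      using hk J.quotient_eq_iff_same_a_r_cos[OF J hc[OF kc[OF b(1)]] b(1)] b by (simp add: hc kc p_def)
    then show "C \<in> p ` carrier A"
      using kc[OF b(1)] by blast
  qed (use P.hom_closed in blast)
  from P.FactRing_iso_set[OF this]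
  have iso: "(\<lambda>X. the_elem (p ` X)) \<in> ring_iso (quot_alg A I) (quot_alg B J)"
    by (simp add: ker ring_iso_quot_alg)
  have "the_elem (p ` (c \<odot>\<^bsub>quot_alg A I\<^esub> X)) = c \<odot>\<^bsub>quot_alg B J\<^esub> the_elem (p ` X)"
    if X: "X \<in> carrier (quot_alg A I)" for c X
  proof -
    obtain a where a: "a \<in> carrier A" "X = I +>\<^bsub>A\<^esub> a"
      using X by (auto simp: quot_alg_simps FactRing_def A_RCOSETS_def')
    have el: "the_elem (p ` (I +>\<^bsub>A\<^esub> x)) = J +>\<^bsub>B\<^esub> h x" if "x \<in> carrier A" for x
      using P.the_elem_simp[OF that] unfolding ker by (simp add: p_def)
    have "c \<odot>\<^bsub>quot_alg A I\<^esub> X = I +>\<^bsub>A\<^esub> (c \<odot>\<^bsub>A\<^esub> a)"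
      unfolding a(2) by (rule smult_quot_alg[OF I a(1) closed(1) diff(1)])
    moreover have "c \<odot>\<^bsub>quot_alg B J\<^esub> (J +>\<^bsub>B\<^esub> h a) = J +>\<^bsub>B\<^esub> (c \<odot>\<^bsub>B\<^esub> h a)"
      by (rule smult_quot_alg[OF J hc[OF a(1)] closed(2) diff(2)])
    ultimately show ?thesis
      using a closed(1) by (simp add: el smult)
  qed
  with iso have "(\<lambda>X. the_elem (p ` X)) \<in> alg_iso (quot_alg A I) (quot_alg B J)"
    unfolding alg_iso_def by (intro CollectI conjI ballI allI)
  then show ?thesis
    by (auto simp: is_alg_iso_def)
qed

section \<open>Substitutions as continuous homomorphisms and the relator ideals\<close>

lemma ser_subst_ring_hom:
  assumes "\<And>i. i < n \<Longrightarrow> \<phi> i \<in> carrier (ser_alg m)" "\<And>i. i < n \<Longrightarrow> \<phi> i [] = 0"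
  shows "ser_subst n \<phi> \<in> ring_hom (ser_alg n) (ser_alg m)"
  using assms by (intro ring_hom_memI)
    (auto simp: ser_alg_simps ser_subst_add ser_subst_one ser_subst_mult fun_eq_iff intro!: ser_subst_closed)

text \<open>If \<open>g\<close> agrees with \<open>f\<close> below degree \<open>N\<close>, then so
  do their images, by \<open>ser_subst_local\<close>.\<close>

lemma ser_subst_closure:
  assumes \<phi>: "\<And>i. i < n \<Longrightarrow> \<phi> i \<in> carrier (ser_alg m)"
    and "ser_subst n \<phi> ` I \<subseteq> J"
  shows "ser_subst n \<phi> ` ser_closure n I \<subseteq> ser_closure m J"
proof
  fix h assume "h \<in> ser_subst n \<phi> ` ser_closure n I"
  then obtain f where f: "f \<in> ser_closure n I" "h = ser_subst n \<phi> f" by blast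
  have "\<exists>g\<in>J. \<forall>w. length w < N \<longrightarrow> h w = g w" for N
  proof -
    obtain g where "g \<in> I" "\<And>w. length w < N \<Longrightarrow> f w = g w"
      using ser_closureE[OF f(1), where N = N] by blast
    then show ?thesis
      using assms(2) by (intro bexI[of _ "ser_subst n \<phi> g"]) (auto simp: f(2) intro!: ser_subst_local)
  qed
  then show "h \<in> ser_closure m J"
    using ser_subst_closed[OF \<phi>] by (simp add: ser_closure_def f(2))
qed

lemma relator_ideal_eq:
  assumes "set rs \<subseteq> carrier (free_group n)"
  defines "I \<equiv> Idl\<^bsub>ser_alg n\<^esub> (relator_series ` set rs)"
  shows "relator_ideal n rs = ser_closure n I" and "ser_ideal n I" and "relator_series ` set rs \<subseteq> I"
proof -
  interpret R: ring "ser_alg n" by (rule ring_ser_alg)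
  have rc: "relator_series ` set rs \<subseteq> carrier (ser_alg n)"
    using assms(1) by (auto intro: relator_series_closed)
  show "ser_ideal n I" "relator_series ` set rs \<subseteq> I"
    unfolding I_def using R.genideal_ideal[OF rc] R.genideal_self[OF rc] by (auto intro: ser_ideal.intro)
  then interpret I: ser_ideal n I by simp
  show "relator_ideal n rs = ser_closure n I"
    unfolding relator_ideal_def by (fold I_def) (rule closure_of_ser_topology[OF I.a_subset])
qed

section \<open>Lifting group homomorphisms to words\<close>

lemma normal_normal_closure:
  assumes "S \<subseteq> carrier (free_group n)"
  shows "normal_closure (free_group n) S \<lhd> free_group n"
proof -
  interpret F: group "free_group n" by (rule group_free_group)
  \<comment> \<open>The whole group is a normal subgroup containing \<open>S\<close>, so the family
    to be intersected is nonempty.\<close>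
  have carrier: "carrier (free_group n) \<lhd> free_group n"
    by (rule F.normal_invI) (auto simp: F.subgroup_self)
  show ?thesis
    unfolding normal_closure_def
  proof (rule F.normal_invI)
    show "subgroup (\<Inter> {N. N \<lhd> free_group n \<and> S \<subseteq> N}) (free_group n)"
      by (rule F.subgroups_Inter) (use carrier assms in \<open>auto dest: normal_imp_subgroup\<close>)
  qed (auto simp: normal.inv_op_closed2)
qed

text \<open>As functions of the word, both sides multiply along its letters, so agreement on
  generators, and hence on their inverses, suffices.\<close>

lemma word_subst_coset:
  assumes N: "N \<lhd> free_group n" and M: "M \<lhd> free_group m"
    and \<alpha>: "\<alpha> \<in> hom (free_group n Mod N) (free_group m Mod M)"
    and u: "\<And>i. i < n \<Longrightarrow> u i \<in> carrier (free_group m)"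
      "\<And>i. i < n \<Longrightarrow> \<alpha> (N #>\<^bsub>free_group n\<^esub> [(i, True)]) = M #>\<^bsub>free_group m\<^esub> u i"
    and w: "w \<in> carrier (free_group n)"
  shows "\<alpha> (N #>\<^bsub>free_group n\<^esub> w) = M #>\<^bsub>free_group m\<^esub> word_subst m u w"
proof -
  let ?F = "free_group n" and ?E = "free_group m"
  interpret N: normal N ?F by (rule N)
  interpret M: normal M ?E by (rule M)
  interpret Q: group "?E Mod M" by (rule M.factorgroup_is_group)
  let ?a = "\<lambda>w. \<alpha> (N #>\<^bsub>?F\<^esub> w)" and ?b = "\<lambda>v. M #>\<^bsub>?E\<^esub> v"
  have "?a \<in> hom ?F (?E Mod M)"
    using hom_compose[OF N.r_coset_hom_Mod \<alpha>] by (simp add: comp_def)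
  then interpret a: group_hom ?F "?E Mod M" ?a
    by unfold_locales
  interpret b: group_hom ?E "?E Mod M" ?b
    by unfold_locales (rule M.r_coset_hom_Mod)
  have letter: "?a [l] = ?b (if snd l then u (fst l) else inv\<^bsub>?E\<^esub> u (fst l))" if "fst l < n" for l
  proof (cases "snd l")
    case True
    then have "l = (fst l, True)" by (simp add: prod_eq_iff)
    then show ?thesis using u(2)[OF that] True by metis
  next
    case False
    define x where "x = [(fst l, True)]"
    have x: "x \<in> carrier ?F" "[l] \<in> carrier ?F"
      using that by (simp_all add: x_def free_group_def)
    have "[l] \<otimes>\<^bsub>?F\<^esub> x = \<one>\<^bsub>?F\<^esub>"
      using False by (simp add: free_group_def x_def push_letter_def letter_inv_def)
    then have "[l] = inv\<^bsub>?F\<^esub> x"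
      using N.inv_equality x by simp
    then have "?a [l] = inv\<^bsub>?E Mod M\<^esub> ?a x"
      using a.hom_inv[OF x(1)] by simp
    also have "\<dots> = ?b (inv\<^bsub>?E\<^esub> u (fst l))"
      using u that by (simp add: x_def)
    finally show ?thesis using False by simp
  qed
  show ?thesis
    using w
  proof (induction w)
    case Nil
    have "?a \<one>\<^bsub>?F\<^esub> = ?b (word_subst m u [])"
      using a.hom_one b.hom_one by (simp add: word_subst_def)
    then show ?case by (simp add: free_group_def)
  next
    case (Cons l w)
    then have w: "w \<in> carrier ?F" "[l] \<in> carrier ?F" "fst l < n"
      by (auto simp: free_group_def dest: reduced_tl)
    \<comment> \<open>The word is reduced, so multiplying by its first letter causes no
      cancellation.\<close>
    have "l # w = [l] \<otimes>\<^bsub>?F\<^esub> w"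
      using Cons.prems by (simp add: free_group_def push_reduced)
    then have "?a (l # w) = ?a [l] \<otimes>\<^bsub>?E Mod M\<^esub> ?a w"
      using a.hom_mult w by metis
    also have "\<dots> = ?b ((if snd l then u (fst l) else inv\<^bsub>?E\<^esub> u (fst l)) \<otimes>\<^bsub>?E\<^esub> word_subst m u w)"
    proof -
      have "word_subst m u w \<in> carrier ?E"
        using w(1) u(1) by (intro word_subst_closed[of n]) (auto simp: free_group_def)
      moreover have "(if snd l then u (fst l) else inv\<^bsub>?E\<^esub> u (fst l)) \<in> carrier ?E"
        using u(1)[OF w(3)] by simp
      ultimately show ?thesis
        by (subst b.hom_mult) (simp_all only: letter[OF w(3)] Cons.IH[OF w(1)])
    qed
    finally show ?case by (simp add: word_subst_def)
  qed
qed

text \<open>The words \<open>u i\<close> are coset representatives of the images of the generators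
  under \<open>\<alpha>\<close>. Relators become words in \<open>M\<close>, whose series lie in the
  other ideal.\<close>

lemma presentation_lift:
  fixes n m :: nat and rs rs' :: "letter list list"
  defines "N \<equiv> normal_closure (free_group n) (set rs)"
    and "M \<equiv> normal_closure (free_group m) (set rs')"
  assumes rs: "set rs \<subseteq> carrier (free_group n)" and rs': "set rs' \<subseteq> carrier (free_group m)"
    and \<alpha>: "\<alpha> \<in> hom (free_group n Mod N) (free_group m Mod M)"
  obtains u where "\<And>i. i < n \<Longrightarrow> u i \<in> carrier (free_group m)"
    and "\<And>w. w \<in> carrier (free_group n) \<Longrightarrow>
      \<alpha> (N #>\<^bsub>free_group n\<^esub> w) = M #>\<^bsub>free_group m\<^esub> word_subst m u w"
    and "ser_subst n (\<lambda>i. relator_series (u i)) ` relator_ideal n rs \<subseteq> relator_ideal m rs'"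
proof -
  let ?F = "free_group n" and ?E = "free_group m"
  have N: "N \<lhd> ?F" and M: "M \<lhd> ?E"
    unfolding N_def M_def using rs rs' by (simp_all add: normal_normal_closure)
  interpret N: normal N ?F by (rule N)
  interpret M: normal M ?E by (rule M)
  have "\<exists>v. v \<in> carrier ?E \<and> \<alpha> (N #>\<^bsub>?F\<^esub> [(i, True)]) = M #>\<^bsub>?E\<^esub> v" if "i < n" for i
  proof -
    have "N #>\<^bsub>?F\<^esub> [(i, True)] \<in> carrier (?F Mod N)"
      using that by (auto simp: carrier_FactGroup free_group_def)
    then have "\<alpha> (N #>\<^bsub>?F\<^esub> [(i, True)]) \<in> carrier (?E Mod M)"
      using \<alpha> by (simp add: hom_in_carrier)
    then show ?thesis by (auto simp: carrier_FactGroup)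
  qed
  then obtain u where u: "\<And>i. i < n \<Longrightarrow> u i \<in> carrier ?E"
    "\<And>i. i < n \<Longrightarrow> \<alpha> (N #>\<^bsub>?F\<^esub> [(i, True)]) = M #>\<^bsub>?E\<^esub> u i"
    by metis
  have coset: "\<alpha> (N #>\<^bsub>?F\<^esub> w) = M #>\<^bsub>?E\<^esub> word_subst m u w" if "w \<in> carrier ?F" for w
    by (rule word_subst_coset[OF N M \<alpha> u that])
  define I where "I = Idl\<^bsub>ser_alg n\<^esub> (relator_series ` set rs)"
  define J where "J = Idl\<^bsub>ser_alg m\<^esub> (relator_series ` set rs')"
  interpret J: ser_ideal m J
    unfolding J_def by (rule relator_ideal_eq(2)[OF rs'])
  have J: "relator_series ` set rs' \<subseteq> J"
    unfolding J_def by (rule relator_ideal_eq(3)[OF rs'])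
  let ?S = "ser_subst n (\<lambda>i. relator_series (u i))"
  have uc: "relator_series (u i) \<in> carrier (ser_alg m)" if "i < n" for i
    using u(1)[OF that] by (rule relator_series_closed)
  interpret S: ring_hom_ring "ser_alg n" "ser_alg m" ?S
    by (intro ring_hom_ringI2 ring_ser_alg ser_subst_ring_hom uc) auto
  have "?S (relator_series r) \<in> J" if "r \<in> set rs" for r
  proof -
    have r: "r \<in> carrier ?F" using that rs by blast
    \<comment> \<open>A relator represents the trivial coset, which \<open>\<alpha>\<close>
      preserves, so the substituted word lies in \<open>M\<close>.\<close>
    have "r \<in> N" using that by (auto simp: N_def normal_closure_def)
    then have "\<alpha> (N #>\<^bsub>?F\<^esub> r) = \<alpha> (\<one>\<^bsub>?F Mod N\<^esub>)"
      using N.coset_join2[OF r N.is_subgroup] by simp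
    also have "\<dots> = M"
      using hom_one[OF \<alpha> N.factorgroup_is_group M.factorgroup_is_group] by simp
    finally have "M #>\<^bsub>?E\<^esub> word_subst m u r = M"
      by (simp add: coset[OF r])
    moreover have wc: "word_subst m u r \<in> carrier ?E"
      using r u(1) by (intro word_subst_closed[of n]) (auto simp: free_group_def)
    ultimately have "word_subst m u r \<in> M"
      using M.coset_join1 M.is_subgroup by blast
    then have "relator_series (word_subst m u r) \<in> J"
      unfolding M_def by (rule J.relator_series_normal_closure[OF rs' J])
    moreover have "?S (relator_series r) = relator_series (word_subst m u r)"
    proof
      fix v
      have magnus_r: "?S (magnus r) = magnus (word_subst m u r)"
        using r by (intro ser_subst_magnus u(1)) (auto simp: free_group_def)
      have "?S (relator_series r) v = ?S (magnus r) v - ?S ser_one v"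
        by (simp add: relator_series_def[of r] ser_subst_diff)
      then show "?S (relator_series r) v = relator_series (word_subst m u r) v"
        by (simp add: magnus_r ser_subst_one) (simp add: relator_series_def)
    qed
    ultimately show ?thesis by simp
  qed
  then have "relator_series ` set rs \<subseteq> {f \<in> carrier (ser_alg n). ?S f \<in> J}"
    using rs by (auto intro: relator_series_closed)
  \<comment> \<open>The preimage of \<open>J\<close> under the homomorphism \<open>?S\<close> is an
    ideal containing the generators of \<open>I\<close>.\<close>
  then have "I \<subseteq> {f \<in> carrier (ser_alg n). ?S f \<in> J}"
    unfolding I_def by (rule S.R.genideal_minimal[OF S.ideal_vimage[OF J.ideal]])
  then have "?S ` ser_closure n I \<subseteq> ser_closure m J"
    by (intro ser_subst_closure uc) auto
  then have "?S ` relator_ideal n rs \<subseteq> relator_ideal m rs'"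
    by (simp add: relator_ideal_eq(1)[OF rs] relator_ideal_eq(1)[OF rs'] I_def J_def)
  with u(1) coset show thesis by (rule that)
qed

text \<open>By \<open>vu\<close>, substituting \<open>v\<close> into \<open>u i\<close> gives the
  generator with index \<open>i\<close> modulo \<open>N\<close>. So the composite fixes each
  variable modulo the algebraic ideal, and \<open>ser_subst_close\<close> extends this to all series
  modulo the closure.\<close>

lemma ser_subst_inverse:
  fixes n m :: nat and rs :: "letter list list"
  defines "N \<equiv> normal_closure (free_group n) (set rs)"
  assumes rs: "set rs \<subseteq> carrier (free_group n)"
    and u: "\<And>i. i < n \<Longrightarrow> u i \<in> carrier (free_group m)"
    and v: "\<And>j. j < m \<Longrightarrow> v j \<in> carrier (free_group n)"
    and vu: "\<And>w. w \<in> carrier (free_group n) \<Longrightarrow>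
      N #>\<^bsub>free_group n\<^esub> word_subst n v (word_subst m u w) = N #>\<^bsub>free_group n\<^esub> w"
    and f: "f \<in> carrier (ser_alg n)"
  shows "ser_subst m (\<lambda>j. relator_series (v j)) (ser_subst n (\<lambda>i. relator_series (u i)) f)
    \<ominus>\<^bsub>ser_alg n\<^esub> f \<in> relator_ideal n rs"
proof -
  let ?F = "free_group n"
  define I where "I = Idl\<^bsub>ser_alg n\<^esub> (relator_series ` set rs)"
  interpret I: ser_ideal n I
    unfolding I_def by (rule relator_ideal_eq(2)[OF rs])
  have I: "relator_series ` set rs \<subseteq> I"
    unfolding I_def by (rule relator_ideal_eq(3)[OF rs])
  interpret N: normal N ?F
    unfolding N_def by (rule normal_normal_closure[OF rs])
  interpret E: group "free_group m" by (rule group_free_group)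
  let ?T = "ser_subst m (\<lambda>j. relator_series (v j))"
  have "(\<lambda>w. ?T (relator_series (u i)) w - ser_var i w) \<in> I" if "i < n" for i
  proof -
    let ?x = "[(i, True)]" and ?y = "word_subst n v (u i)"
    have x: "?x \<in> carrier ?F" using that by (simp add: free_group_def)
    have y: "?y \<in> carrier ?F"
      using u[OF that] v by (intro word_subst_closed[of m]) (auto simp: free_group_def)
    have "word_subst m u ?x = u i"
      using u[OF that] by (simp add: word_subst_def)
    then have "N #>\<^bsub>?F\<^esub> ?y = N #>\<^bsub>?F\<^esub> ?x"
      using vu[OF x] by simp
    then have "?y \<otimes>\<^bsub>?F\<^esub> inv\<^bsub>?F\<^esub> ?x \<in> N"
      using N.rcos_self[OF y N.is_subgroup] N.rcos_module_imp[OF N.is_group x] by simp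
    then have "(\<lambda>w. magnus ?y w - magnus ?x w) \<in> I"
      unfolding N_def by (rule I.magnus_diff_mem[OF rs I y x])
    \<comment> \<open>The constant 1 moves across: (y - 1) - X_i = y - (1 + X_i), and 1 + X_i is the
      expansion of \<open>?x\<close>.\<close>
    moreover have "(\<lambda>w. magnus ?y w - magnus ?x w) = (\<lambda>w. ?T (relator_series (u i)) w - ser_var i w)"
    proof -
      have "?T (relator_series (u i)) = (\<lambda>w. magnus ?y w - ser_one w)"
        using u[OF that] v ser_subst_magnus[of m v n "u i"]
        by (auto simp: relator_series_def[of "u i"] ser_subst_diff ser_subst_one fun_eq_iff free_group_def)
      then show ?thesis by (simp add: magnus_letter_def diff_diff_eq)
    qed
    ultimately show ?thesis by simp
  qed
  then have "(\<lambda>w. ?T (ser_subst n (\<lambda>i. relator_series (u i)) f) w - f w) \<in> ser_closure n I"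
    using u v f by (intro I.ser_subst_close) (auto intro: relator_series_closed)
  moreover have "?T g \<in> carrier (ser_alg n)" for g
    using v by (intro ser_subst_closed relator_series_closed)
  ultimately show ?thesis
    using f by (simp add: relator_ideal_eq(1)[OF rs] I_def ser_alg_minus)
qed

section \<open>Independence of the presentation\<close>

theorem proposition6p1:
  fixes G :: "('g, 'b) monoid_scheme"
    and n n' :: nat and rs rs' :: "letter list list"
  assumes "group G"
    and "is_presentation n rs G"
    and "is_presentation n' rs' G"
  shows "is_alg_iso (presentation_alg n rs) (presentation_alg n' rs')"
proof -
  let ?F = "free_group n" and ?F' = "free_group n'"
  define N where "N = normal_closure ?F (set rs)"
  define N' where "N' = normal_closure ?F' (set rs')"
  have rs: "set rs \<subseteq> carrier ?F" and rs': "set rs' \<subseteq> carrier ?F'"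
    and iso: "?F Mod N \<cong> G" "?F' Mod N' \<cong> G"
    using assms(2,3) by (auto simp: is_presentation_def N_def N'_def)
  interpret N: normal N ?F
    unfolding N_def by (rule normal_normal_closure[OF rs])
  interpret N': normal N' ?F'
    unfolding N'_def by (rule normal_normal_closure[OF rs'])
  have "G \<cong> ?F' Mod N'"
    using group.iso_sym[OF N'.factorgroup_is_group iso(2)] .
  with iso(1) have "?F Mod N \<cong> ?F' Mod N'" by (rule iso_trans)
  then obtain \<alpha> \<beta> where "group_isomorphisms (?F Mod N) (?F' Mod N') \<alpha> \<beta>"
    using group.iso_iff_group_isomorphisms[OF N.factorgroup_is_group] unfolding is_iso_def by blast
  then have \<alpha>: "\<alpha> \<in> hom (?F Mod N) (?F' Mod N')" and \<beta>: "\<beta> \<in> hom (?F' Mod N') (?F Mod N)"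
    and \<beta>\<alpha>: "\<And>x. x \<in> carrier (?F Mod N) \<Longrightarrow> \<beta> (\<alpha> x) = x"
    and \<alpha>\<beta>: "\<And>y. y \<in> carrier (?F' Mod N') \<Longrightarrow> \<alpha> (\<beta> y) = y"
    by (auto simp: group_isomorphisms_def)
  obtain u where u: "\<And>i. i < n \<Longrightarrow> u i \<in> carrier ?F'"
    "\<And>w. w \<in> carrier ?F \<Longrightarrow> \<alpha> (N #>\<^bsub>?F\<^esub> w) = N' #>\<^bsub>?F'\<^esub> word_subst n' u w"
    "ser_subst n (\<lambda>i. relator_series (u i)) ` relator_ideal n rs \<subseteq> relator_ideal n' rs'"
    using presentation_lift[OF rs rs' \<alpha>[unfolded N_def N'_def]] unfolding N_def N'_def by metis
  obtain v where v: "\<And>i. i < n' \<Longrightarrow> v i \<in> carrier ?F"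
    "\<And>w. w \<in> carrier ?F' \<Longrightarrow> \<beta> (N' #>\<^bsub>?F'\<^esub> w) = N #>\<^bsub>?F\<^esub> word_subst n v w"
    "ser_subst n' (\<lambda>i. relator_series (v i)) ` relator_ideal n' rs' \<subseteq> relator_ideal n rs"
    using presentation_lift[OF rs' rs \<beta>[unfolded N_def N'_def]] unfolding N_def N'_def by metis
  have uc: "word_subst n' u w \<in> carrier ?F'" if "w \<in> carrier ?F" for w
    using that u(1) by (intro word_subst_closed[of n]) (auto simp: free_group_def)
  have vc: "word_subst n v w \<in> carrier ?F" if "w \<in> carrier ?F'" for w
    using that v(1) by (intro word_subst_closed[of n']) (auto simp: free_group_def)
  \<comment> \<open>The identity \<open>\<beta> (\<alpha> x) = x\<close>, read on the coset of
    \<open>w\<close>: substituting twice returns \<open>w\<close> modulo \<open>N\<close>.\<close>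
  have vu: "N #>\<^bsub>?F\<^esub> word_subst n v (word_subst n' u w) = N #>\<^bsub>?F\<^esub> w" if "w \<in> carrier ?F" for w
    using \<beta>\<alpha>[of "N #>\<^bsub>?F\<^esub> w"] that by (auto simp: u(2) v(2)[OF uc] carrier_FactGroup)
  have uv: "N' #>\<^bsub>?F'\<^esub> word_subst n' u (word_subst n v w) = N' #>\<^bsub>?F'\<^esub> w" if "w \<in> carrier ?F'" for w
    using \<alpha>\<beta>[of "N' #>\<^bsub>?F'\<^esub> w"] that by (auto simp: v(2) u(2)[OF vc] carrier_FactGroup)
  have ideal: "ideal (relator_ideal n rs) (ser_alg n)" if "set rs \<subseteq> carrier (free_group n)" for n rs
    using relator_ideal_eq(1,2)[OF that] ser_ideal.ideal_closure by simp
  \<comment> \<open>The closed ideal is again a \<open>ser_ideal\<close>, so \<open>scale\<close>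
    applies to the difference \<open>a - b\<close>.\<close>
  have diff: "c \<odot>\<^bsub>ser_alg n\<^esub> a \<ominus>\<^bsub>ser_alg n\<^esub> c \<odot>\<^bsub>ser_alg n\<^esub> b \<in> relator_ideal n rs"
    if "set rs \<subseteq> carrier (free_group n)" "a \<in> carrier (ser_alg n)" "b \<in> carrier (ser_alg n)"
      "a \<ominus>\<^bsub>ser_alg n\<^esub> b \<in> relator_ideal n rs" for n rs c a b
    using ser_ideal.scale[OF ser_ideal.intro[OF ideal[OF that(1)]] that(4), of c] that(2,3)
    by (simp add: ser_alg_simps(5) ser_alg_minus ser_scale_closed right_diff_distrib)
  show ?thesis
    unfolding presentation_alg_def
  proof (rule is_alg_iso_quot_algI[OF ideal[OF rs] ideal[OF rs'] _ _ u(3) v(3)])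
    show "ser_subst n (\<lambda>i. relator_series (u i)) \<in> ring_hom (ser_alg n) (ser_alg n')"
      "ser_subst n' (\<lambda>i. relator_series (v i)) \<in> ring_hom (ser_alg n') (ser_alg n)"
      using u(1) v(1) by (auto intro!: ser_subst_ring_hom relator_series_closed)
  \<comment> \<open>Both congruences with the identity come from \<open>ser_subst_inverse\<close>,
    used once for each presentation; the remaining goals concern scalars.\<close>
  qed (use rs rs' u(1) v(1) vu uv in \<open>auto simp: ser_alg_simps(5) ser_subst_scale ser_scale_closed fun_eq_iff
      intro!: ser_subst_inverse diff[unfolded ser_alg_simps(5)] simp flip: N_def N'_def\<close>)
qed

end
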